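(* Let $K$ be a field, let $s\ge 1$ be an integer, let $B$ be a polynomial ring in $s$ variables over $K$, and let $J\subset B$ be a nonzero proper complete intersection monomial ideal minimally generated by $t$ monomials, $t\le s$. Then for all integers $k\ge 1$, $$s-t+1\ \le\ \operatorname{sdepth}_B(J^k)\ \le\ s-t+\left\lceil\frac{t}{k+1}\right\rceil .$$ In particular, if $k\ge t-1$, then $\operatorname{sdepth}_B(J^k)=s-t+1$.
   Context: A monomial ideal is a complete intersection if its minimal monomial generators form a regular sequence, equivalently, if they have pairwise disjoint supports (no variable divides two distinct minimal generators). Stanley depth: let $S$ be a polynomial ring over $K$ in $N$ variables $x_1,\ldots,x_N$ and let $M$ be a finitely generated $\mathbb Z^N$-graded $S$-module. A Stanley decomposition of $M$ is a finite direct sum decomposition $\mathcal D: M=\bigoplus_{i=1}^{q} m_iK[Z_i]$ as a $\mathbb Z^N$-graded $K$-vector space, where each $m_i\in M$ is homogeneous, $Z_i\subset\{x_1,\ldots,x_N\}$, and $m_iK[Z_i]=\{um_i: u\in K[Z_i]\}$ is a free $K[Z_i]$-submodule of $M$. Put $\operatorname{sdepth}(\mathcal D)=\min_i|Z_i|$ and let $\operatorname{sdepth}_S(M)$ be the maximum of $\operatorname{sdepth}(\mathcal D)$ over all Stanley decompositions $\mathcal D$ of $M$. *)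

theory Defs
  imports Complex_Main "HOL-Library.Poly_Mapping" "HOL-Library.Cardinality"
begin

text \<open>
  The polynomial ring over a field \<open>'k\<close> whose variables are the elements of the finite type \<open>'x\<close>:
  an exponent vector is a finitely supported map \<open>'x \<Rightarrow>\<^sub>0 nat\<close>, and a polynomial is a finitely
  supported map from exponent vectors to coefficients, multiplied by convolution.
\<close>

type_synonym ('x, 'k) mpoly = "('x \<Rightarrow>\<^sub>0 nat) \<Rightarrow>\<^sub>0 'k"

definition monomials :: "('x::finite, 'k::field) mpoly set" where
  "monomials = range (\<lambda>a. Poly_Mapping.single a 1)"

definition polys_in :: "'x set \<Rightarrow> ('x::finite, 'k::field) mpoly set" where
  "polys_in Z = {u. \<forall>b\<in>Poly_Mapping.keys u. Poly_Mapping.keys b \<subseteq> Z}"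

text \<open>
  The homogeneous component of degree \<open>a\<close> of the polynomial ring, which is zero if \<open>a\<close> has a
  negative entry.
\<close>

definition poly_component :: "('x \<Rightarrow> int) \<Rightarrow> ('x::finite, 'k::field) mpoly set" where
  "poly_component a = {f. \<forall>b\<in>Poly_Mapping.keys f. (\<lambda>x. int (Poly_Mapping.lookup b x)) = a}"


section \<open>Ideals\<close>

text \<open>
  A commutative ring as a module over itself: \<open>ideal.subspace\<close> says that a set is an ideal, and
  \<open>ideal.span G\<close> is the ideal generated by \<open>G\<close>.
\<close>

interpretation ideal: module "(*) :: 'a::comm_ring_1 \<Rightarrow> 'a \<Rightarrow> 'a"
  by unfold_locales (simp_all add: algebra_simps)

primrec ideal_power :: "'a::comm_ring_1 set \<Rightarrow> nat \<Rightarrow> 'a set" where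
  "ideal_power I 0 = UNIV"
| "ideal_power I (Suc n) = ideal.span {a * b |a b. a \<in> I \<and> b \<in> ideal_power I n}"

definition regular_sequence :: "'a::comm_ring_1 list \<Rightarrow> bool" where
  "regular_sequence gs \<longleftrightarrow>
     ideal.span (set gs) \<noteq> UNIV \<and>
     (\<forall>i<length gs. \<forall>f. gs ! i * f \<in> ideal.span (set (take i gs)) \<longrightarrow>
        f \<in> ideal.span (set (take i gs)))"

definition minimal_monomial_generators ::
    "('x::finite, 'k::field) mpoly set \<Rightarrow> ('x, 'k) mpoly set \<Rightarrow> bool" where
  "minimal_monomial_generators J G \<longleftrightarrow>
     G \<subseteq> monomials \<and> ideal.span G = J \<and> (\<forall>H. H \<subset> G \<longrightarrow> ideal.span H \<noteq> J)"

text \<open>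
  The order of the generators is irrelevant for homogeneous elements, so it suffices to ask that
  some enumeration of the minimal monomial generators be a regular sequence.
\<close>

definition complete_intersection_monomial_ideal :: "('x::finite, 'k::field) mpoly set \<Rightarrow> bool" where
  "complete_intersection_monomial_ideal J \<longleftrightarrow>
     (\<exists>gs. distinct gs \<and> minimal_monomial_generators J (set gs) \<and> regular_sequence gs)"


section \<open>Stanley depth\<close>

definition internal_direct_sum :: "'m::ab_group_add set \<Rightarrow> 'm set list \<Rightarrow> bool" where
  "internal_direct_sum M Vs \<longleftrightarrow>
     M = {\<Sum>i<length Vs. v i |v. \<forall>i<length Vs. v i \<in> Vs ! i} \<and>
     (\<forall>v. (\<forall>i<length Vs. v i \<in> Vs ! i) \<and> (\<Sum>i<length Vs. v i) = 0 \<longrightarrow>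
        (\<forall>i<length Vs. v i = 0))"

text \<open>
  In the following definitions \<open>M\<close> is meant to be a finitely generated multigraded module over the
  polynomial ring with scalar multiplication \<open>scale\<close>, and \<open>gr a \<subseteq> M\<close> is its homogeneous component
  of degree \<open>a\<close>. A pair \<open>(m, Z)\<close> stands for the Stanley space \<open>m K[Z]\<close>. As \<open>m\<close> is homogeneous, each
  Stanley space is a graded subspace, so a direct sum of Stanley spaces is one of graded vector
  spaces.
\<close>

definition stanley_space ::
    "(('x::finite, 'k::field) mpoly \<Rightarrow> 'm \<Rightarrow> 'm) \<Rightarrow> 'm \<times> 'x set \<Rightarrow> 'm set" where
  "stanley_space scale = (\<lambda>(m, Z). {scale u m |u. u \<in> polys_in Z})"

definition stanley_decomposition ::
    "(('x::finite, 'k::field) mpoly \<Rightarrow> 'm \<Rightarrow> 'm) \<Rightarrow> (('x \<Rightarrow> int) \<Rightarrow> 'm set) \<Rightarrow>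
       'm::ab_group_add set \<Rightarrow> ('m \<times> 'x set) list \<Rightarrow> bool" where
  "stanley_decomposition scale gr M D \<longleftrightarrow>
     (\<forall>(m, Z)\<in>set D. m \<in> M \<and> (\<exists>a. m \<in> gr a) \<and> (\<forall>u\<in>polys_in Z. scale u m = 0 \<longrightarrow> u = 0)) \<and>
     internal_direct_sum M (map (stanley_space scale) D)"

text \<open>
  For \<open>M \<noteq> 0\<close> every Stanley decomposition is nonempty; the minimum and the maximum below are not
  meaningful for \<open>M = 0\<close>.
\<close>

definition sdepth_decomposition :: "('m \<times> 'x set) list \<Rightarrow> nat" where
  "sdepth_decomposition D = Min ((\<lambda>(m, Z). card Z) ` set D)"

definition sdepth ::
    "(('x::finite, 'k::field) mpoly \<Rightarrow> 'm \<Rightarrow> 'm) \<Rightarrow> (('x \<Rightarrow> int) \<Rightarrow> 'm set) \<Rightarrow>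
       'm::ab_group_add set \<Rightarrow> nat" where
  "sdepth scale gr M = Max (sdepth_decomposition ` {D. stanley_decomposition scale gr M D})"

definition sdepth_ideal :: "('x::finite, 'k::field) mpoly set \<Rightarrow> nat" where
  "sdepth_ideal I = sdepth (*) (\<lambda>a. I \<inter> poly_component a) I"

end

theory Submission
  imports Defs "HOL-Library.Multiset" "HOL-Library.Disjoint_Sets"
begin

text \<open>
  A Stanley decomposition of a monomial ideal is the same as a partition of its set of exponent
  vectors into finitely many cones \<open>a + \<nat>\<^sup>Z\<close>. The generators \<open>u\<^sub>1, \<dots>, u\<^sub>t\<close> have pairwise disjoint
  supports, so a monomial lies in \<open>J\<^sup>k\<close> iff the exponents of the largest powers of the \<open>u\<^sub>i\<close> dividing
  it add up to at least \<open>k\<close>.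

  Lower bound: sorting monomials by the largest power of \<open>u\<^sub>1\<close> dividing them costs one dimension, and
  none where this power is at least \<open>k\<close>; by recursion on the generators \<open>t - 1\<close> dimensions are lost.

  Upper bound: let \<open>N\<^sub>k = (t + k - 1 choose k)\<close> be the number of monomials of degree \<open>k\<close> in the \<open>u\<^sub>i\<close>.
  In a decomposition of depth \<open>d\<close>, each of these monomials has at least \<open>d - (s - t)\<close> multiples
  of degree \<open>k + 1\<close> in the cone that contains it, and these are all different; hence
  \<open>(d - (s - t)) N\<^sub>k \<le> N\<^sub>k\<^sub>+\<^sub>1\<close>, where \<open>(k + 1) N\<^sub>k\<^sub>+\<^sub>1 = (t + k) N\<^sub>k\<close>.
\<close>


section \<open>Cones of exponent vectors\<close>

definition cone :: "('x \<Rightarrow> nat) \<Rightarrow> 'x set \<Rightarrow> ('x \<Rightarrow> nat) set" where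
  "cone a Z = {w. \<forall>x. if x \<in> Z then a x \<le> w x else w x = a x}"

lemma cone_UNIV: "cone a UNIV = {a..}"
  by (auto simp: cone_def le_fun_def)

lemma base_in_cone: "a \<in> cone a Z"
  by (simp add: cone_def)

text \<open>A coordinate outside \<open>Z \<inter> W\<close> is frozen in at least one of the cones,
  so all common points agree there with the given common point \<open>w\<close>; on
  \<open>Z \<inter> W\<close> only the two lower bounds remain.\<close>

lemma cone_Int_cone:
  assumes "w \<in> cone a Z \<inter> cone b W"
  shows "cone a Z \<inter> cone b W = cone (\<lambda>x. if x \<in> Z \<inter> W then max (a x) (b x) else w x) (Z \<inter> W)"
    (is "_ = cone ?c _")
proof (intro set_eqI)
  fix v
  have "(if x \<in> Z then a x \<le> v x else v x = a x) \<and> (if x \<in> W then b x \<le> v x else v x = b x) \<longleftrightarrow>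
      (if x \<in> Z \<inter> W then ?c x \<le> v x else v x = ?c x)" for x
  proof -
    have "if x \<in> Z then a x \<le> w x else w x = a x" "if x \<in> W then b x \<le> w x else w x = b x"
      using assms by (auto simp: cone_def)
    then show ?thesis
      by (auto split: if_splits)
  qed
  then show "v \<in> cone a Z \<inter> cone b W \<longleftrightarrow> v \<in> cone ?c (Z \<inter> W)"
    unfolding cone_def Int_iff mem_Collect_eq by blast
qed

text \<open>The parameter bounds the number of frozen coordinates, the codimension, rather than the
  dimension, because codimensions add up when partitions are intersected.\<close>

definition cone_partitionable :: "nat \<Rightarrow> ('x \<Rightarrow> nat) set \<Rightarrow> bool" where
  "cone_partitionable c A \<longleftrightarrow>
     (\<exists>P. finite P \<and> disjoint P \<and> \<Union>P = A \<and> (\<forall>C\<in>P. \<exists>a Z. C = cone a Z \<and> card (- Z) \<le> c))"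

lemma cone_partitionable_cone: "card (- Z) \<le> c \<Longrightarrow> cone_partitionable c (cone a Z)"
  unfolding cone_partitionable_def by (rule exI[of _ "{cone a Z}"]) auto

lemma cone_partitionable_empty: "cone_partitionable c {}"
  unfolding cone_partitionable_def by (rule exI[of _ "{}"]) auto

lemma cone_partitionable_Un:
  assumes "cone_partitionable c A" and "cone_partitionable c B" and "A \<inter> B = {}"
  shows "cone_partitionable c (A \<union> B)"
proof -
  obtain P Q where
    P: "finite P" "disjoint P" "\<Union>P = A" "\<forall>C\<in>P. \<exists>a Z. C = cone a Z \<and> card (- Z) \<le> c" and
    Q: "finite Q" "disjoint Q" "\<Union>Q = B" "\<forall>C\<in>Q. \<exists>a Z. C = cone a Z \<and> card (- Z) \<le> c"
    using assms(1,2) unfolding cone_partitionable_def by metis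
  have "disjoint (P \<union> Q)"
    using P Q assms(3) by (intro disjoint_union) auto
  then show ?thesis
    unfolding cone_partitionable_def using P Q by (intro exI[of _ "P \<union> Q"]) auto
qed

lemma cone_partitionable_UN:
  assumes "finite I" and "\<And>i. i \<in> I \<Longrightarrow> cone_partitionable c (A i)" and "disjoint_family_on A I"
  shows "cone_partitionable c (\<Union>i\<in>I. A i)"
  using assms
proof (induction I rule: finite_induct)
  case empty
  show ?case by (simp add: cone_partitionable_empty)
next
  case (insert i I)
  have "A i \<inter> (\<Union>j\<in>I. A j) = {}"
    using insert.prems(2) insert.hyps(2) by (fastforce simp: disjoint_family_on_def)
  moreover have "cone_partitionable c (\<Union>j\<in>I. A j)"
    using insert by (auto simp: disjoint_family_on_def)
  ultimately show ?case
    using cone_partitionable_Un[of c "A i"] insert.prems(1)[of i] by simp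
qed

text \<open>The common refinement of the two partitions works: nonempty blocks are cones by
  \<open>cone_Int_cone\<close>, and their frozen coordinates are the union of those of the two
  factors.\<close>

lemma cone_partitionable_Int:
  fixes A B :: "('x::finite \<Rightarrow> nat) set"
  assumes "cone_partitionable c A" and "cone_partitionable d B"
  shows "cone_partitionable (c + d) (A \<inter> B)"
proof -
  obtain P Q where
    P: "finite P" "disjoint P" "\<Union>P = A" "\<forall>C\<in>P. \<exists>a Z. C = cone a Z \<and> card (- Z) \<le> c" and
    Q: "finite Q" "disjoint Q" "\<Union>Q = B" "\<forall>C\<in>Q. \<exists>a Z. C = cone a Z \<and> card (- Z) \<le> d"
    using assms unfolding cone_partitionable_def by metis
  have eq: "A \<inter> B = (\<Union>(C, D)\<in>P \<times> Q. C \<inter> D)"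
    using P(3) Q(3) by auto
  have "cone_partitionable (c + d) (C \<inter> D)" if CD: "C \<in> P" "D \<in> Q" for C D
  proof (cases "C \<inter> D = {}")
    case False
    obtain a Z where C: "C = cone a Z" "card (- Z) \<le> c"
      using CD(1) P(4) by metis
    obtain b W where D: "D = cone b W" "card (- W) \<le> d"
      using CD(2) Q(4) by metis
    obtain w where w: "w \<in> cone a Z \<inter> cone b W"
      using False C(1) D(1) by auto
    have "card (- (Z \<inter> W)) \<le> c + d"
      using C(2) D(2) card_Un_le[of "- Z" "- W"] by simp
    then show ?thesis
      unfolding C(1) D(1) cone_Int_cone[OF w] by (rule cone_partitionable_cone)
  qed (simp add: cone_partitionable_empty)
  moreover have "disjoint_family_on (\<lambda>(C, D). C \<inter> D) (P \<times> Q)"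
    unfolding disjoint_family_on_def
  proof (intro ballI impI)
    fix X Y assume "X \<in> P \<times> Q" "Y \<in> P \<times> Q" "X \<noteq> Y"
    then have "fst X \<inter> fst Y = {} \<or> snd X \<inter> snd Y = {}"
      using P(2) Q(2) unfolding disjoint_def by (metis SigmaE prod.sel)
    then show "(case X of (C, D) \<Rightarrow> C \<inter> D) \<inter> (case Y of (C, D) \<Rightarrow> C \<inter> D) = {}"
      by (auto simp: case_prod_beta)
  qed
  ultimately show ?thesis
    unfolding eq using P(1) Q(1) by (intro cone_partitionable_UN) auto
qed

text \<open>The corner \<open>a\<close> is raised to \<open>b\<close> one coordinate at a time.
  Raising coordinate \<open>x\<close> removes the vectors whose entry at \<open>x\<close> is one of
  finitely many values, and each value gives a cone frozen only at \<open>x\<close>.\<close>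

lemma cone_partitionable_orthant_Diff:
  fixes a b :: "'x::finite \<Rightarrow> nat"
  assumes "a \<le> b"
  shows "cone_partitionable 1 ({a..} - {b..})"
proof -
  \<comment> \<open>\<open>F\<close> contains the coordinates still to be raised; \<open>a\<close>
    must vary in the induction since it is the moving corner.\<close>
  have "a \<le> b \<Longrightarrow> (\<forall>x. x \<notin> F \<longrightarrow> a x = b x) \<Longrightarrow> cone_partitionable 1 ({a..} - {b..})"
    if "finite F" for F :: "'x set" and a
    using that
  proof (induction F arbitrary: a rule: finite_induct)
    case empty
    then have "a = b" by auto
    then show ?case by (simp add: cone_partitionable_empty)
  next
    case (insert x F)
    define a' where "a' = a(x := b x)"
    have "a \<le> a'" "a' \<le> b"
      using insert.prems(1) by (auto simp: a'_def le_fun_def)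
    have slice: "{a..} - {a'..} = (\<Union>n\<in>{a x..<b x}. cone (a(x := n)) (- {x}))"
    proof (intro set_eqI)
      fix w
      have "w \<in> {a..} - {a'..} \<longleftrightarrow> (\<forall>y. a y \<le> w y) \<and> w x < b x"
        unfolding a'_def by (auto simp: le_fun_def not_le[symmetric])
      also have "\<dots> \<longleftrightarrow> a x \<le> w x \<and> w x < b x \<and> (\<forall>y. y \<noteq> x \<longrightarrow> a y \<le> w y)"
        by metis
      also have "\<dots> \<longleftrightarrow> w \<in> (\<Union>n\<in>{a x..<b x}. cone (a(x := n)) (- {x}))"
        by (auto simp: cone_def)
      finally show "w \<in> {a..} - {a'..} \<longleftrightarrow> w \<in> (\<Union>n\<in>{a x..<b x}. cone (a(x := n)) (- {x}))" .
    qed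
    have "cone_partitionable 1 ({a..} - {a'..})"
      unfolding slice
      by (intro cone_partitionable_UN cone_partitionable_cone)
        (auto simp: disjoint_family_on_def cone_def)
    moreover have "cone_partitionable 1 ({a'..} - {b..})"
      using insert.prems(2) by (intro insert.IH \<open>a' \<le> b\<close>) (auto simp: a'_def)
    moreover have "{a..} - {b..} = ({a..} - {a'..}) \<union> ({a'..} - {b..})"
      using \<open>a \<le> a'\<close> \<open>a' \<le> b\<close> by auto
    ultimately show ?case
      using cone_partitionable_Un[of 1 "{a..} - {a'..}" "{a'..} - {b..}"] by auto
  qed
  then show ?thesis
    using assms by (metis UNIV_I finite)
qed


section \<open>Exponents of the powers of a monomial ideal\<close>

text \<open>A multiset of size \<open>k\<close> over \<open>U\<close> encodes a product of
  \<open>k\<close> generators with repetition, and \<open>w\<close> is the exponent of a monomial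
  divisible by such a product.\<close>

definition power_exponents :: "('x \<Rightarrow> nat) set \<Rightarrow> nat \<Rightarrow> ('x \<Rightarrow> nat) set" where
  "power_exponents U k = {w. \<exists>M\<in>multisets_of_size U k. \<forall>x. (\<Sum>u\<in>#M. u x) \<le> w x}"

lemma power_exponentsI:
  "M \<in> multisets_of_size U k \<Longrightarrow> (\<And>x. (\<Sum>u\<in>#M. u x) \<le> w x) \<Longrightarrow> w \<in> power_exponents U k"
  by (auto simp: power_exponents_def)

lemma power_exponents_upward:
  "v \<in> power_exponents U k \<Longrightarrow> v \<le> w \<Longrightarrow> w \<in> power_exponents U k"
  unfolding power_exponents_def le_fun_def by (auto intro: order_trans)

lemma power_exponents_0: "power_exponents U 0 = UNIV"
  by (auto simp: power_exponents_def)

text \<open>Splitting one factor off the product mirrors the recursion of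
  \<open>ideal_power\<close>.\<close>

lemma power_exponents_Suc:
  "power_exponents U (Suc k) = {w. \<exists>u\<in>U. \<exists>v\<in>power_exponents U k. \<forall>x. u x + v x \<le> w x}"
proof (intro set_eqI iffI)
  fix w assume "w \<in> power_exponents U (Suc k)"
  then obtain M where M: "set_mset M \<subseteq> U" "size M = Suc k" "\<And>x. (\<Sum>u\<in>#M. u x) \<le> w x"
    by (auto simp: power_exponents_def multisets_of_size_def)
  obtain u N where N: "M = add_mset u N"
    using M(2) by (metis size_eq_Suc_imp_eq_union)
  have "(\<lambda>x. \<Sum>u\<in>#N. u x) \<in> power_exponents U k"
    using M N by (intro power_exponentsI[of N]) (auto simp: multisets_of_size_def)
  then show "w \<in> {w. \<exists>u\<in>U. \<exists>v\<in>power_exponents U k. \<forall>x. u x + v x \<le> w x}"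
    using M N by (intro CollectI bexI[of _ u] bexI[of _ "\<lambda>x. \<Sum>u\<in>#N. u x"]) auto
next
  fix w assume "w \<in> {w. \<exists>u\<in>U. \<exists>v\<in>power_exponents U k. \<forall>x. u x + v x \<le> w x}"
  then obtain u v M where *: "u \<in> U" "\<And>x. u x + v x \<le> w x"
    "M \<in> multisets_of_size U k" "\<And>x. (\<Sum>u\<in>#M. u x) \<le> v x"
    by (auto simp: power_exponents_def)
  have "(\<Sum>u\<in>#add_mset u M. u x) \<le> w x" for x
    using *(2)[of x] *(4)[of x] by simp
  then show "w \<in> power_exponents U (Suc k)"
    using *(1,3) by (intro power_exponentsI[of "add_mset u M"]) (auto simp: multisets_of_size_def)
qed

lemma power_exponents_antimono:
  assumes "m \<le> n"
  shows "power_exponents U n \<subseteq> power_exponents U m"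
proof (rule lift_Suc_antimono_le[OF _ assms])
  fix n
  show "power_exponents U (Suc n) \<subseteq> power_exponents U n"
    unfolding power_exponents_Suc le_fun_def
    by (auto elim!: power_exponents_upward simp: le_fun_def) (metis add_leD2)
qed

lemma power_exponents_singleton: "power_exponents {u} k = {(\<lambda>x. k * u x)..}"
proof -
  have "multisets_of_size {u} k = {replicate_mset k u}"
    by (auto simp: multisets_of_size_def set_mset_subset_singletonD split: if_splits)
  then show ?thesis
    by (auto simp: power_exponents_def le_fun_def)
qed

text \<open>Exponent vectors are sorted by the largest power of \<open>u\<close> dividing them, up to the power \<open>k\<close>.\<close>

lemma power_exponents_insert:
  assumes "u \<notin> U" and disj: "\<And>v x. v \<in> U \<Longrightarrow> u x = 0 \<or> v x = 0"
  shows "power_exponents (insert u U) k =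
    {(\<lambda>x. k * u x)..} \<union>
    (\<Union>c<k. ({(\<lambda>x. c * u x)..} - {(\<lambda>x. Suc c * u x)..}) \<inter> power_exponents U (k - c))"
    (is "?L = ?R")
proof (intro equalityI subsetI)
  fix w assume "w \<in> ?L"
  then obtain n N where N: "n \<le> k" "N \<in> multisets_of_size U (k - n)"
    and w: "\<And>x. (\<Sum>v\<in>#N + replicate_mset n u. v x) \<le> w x"
    unfolding power_exponents_def multisets_of_size_insert[OF assms(1)] by auto
  have w': "(\<Sum>v\<in>#N. v x) + n * u x \<le> w x" for x
    using w[of x] by simp
  show "w \<in> ?R"
  proof (cases "\<forall>x. k * u x \<le> w x")
    case False
    \<comment> \<open>\<open>c\<close> is the exact power of \<open>u\<close> dividing
      \<open>w\<close>: the first \<open>c\<close> for which the next power fails. It is below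
      \<open>k\<close> because the \<open>k\<close>-th power fails.\<close>
    define c where "c = (LEAST c. \<not> (\<forall>x. Suc c * u x \<le> w x))"
    have "k \<noteq> 0" using False by (intro notI) simp
    then have "\<not> (\<forall>x. Suc (k - 1) * u x \<le> w x)" using False by simp
    then have c: "\<not> (\<forall>x. Suc c * u x \<le> w x)" and "c \<le> k - 1"
      unfolding c_def by (rule LeastI, rule Least_le)
    then have "c < k" using \<open>k \<noteq> 0\<close> by simp
    have "\<forall>x. c * u x \<le> w x"
    proof (cases c)
      case (Suc m)
      then show ?thesis using not_less_Least[of m "\<lambda>c. \<not> (\<forall>x. Suc c * u x \<le> w x)"] c_def by auto
    qed simp
    \<comment> \<open>The witnessing product may use \<open>u\<close> fewer than \<open>c\<close>
      times; then its remaining part has at least \<open>k - c\<close> factors, and antimonotonicity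
      discards the surplus.\<close>
    moreover have "n \<le> c"
    proof (rule ccontr)
      assume "\<not> n \<le> c"
      then have "Suc c * u x \<le> n * u x" for x by (intro mult_right_mono) auto
      then show False using c w' by (meson add_leD2 order_trans)
    qed
    moreover have "w \<in> power_exponents U (k - n)"
      using N(2) w' by (intro power_exponentsI[of N]) (auto intro: add_leD1)
    then have "w \<in> power_exponents U (k - c)"
      using power_exponents_antimono[OF diff_le_mono2[OF \<open>n \<le> c\<close>]] by blast
    ultimately show ?thesis
      using c \<open>c < k\<close> by (auto simp: le_fun_def)
  qed (simp add: le_fun_def)
next
  fix w assume "w \<in> ?R"
  then consider "\<forall>x. k * u x \<le> w x"
    | c where "c < k" "\<forall>x. c * u x \<le> w x" "w \<in> power_exponents U (k - c)"
    by (auto simp: le_fun_def)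
  then show "w \<in> ?L"
  proof cases
    case 1
    then show ?thesis
      by (intro power_exponentsI[of "replicate_mset k u"]) (auto simp: multisets_of_size_def)
  next
    case 2
    obtain N where N: "N \<in> multisets_of_size U (k - c)" "\<And>x. (\<Sum>v\<in>#N. v x) \<le> w x"
      using 2(3) by (auto simp: power_exponents_def)
    \<comment> \<open>Divisibility by the power of \<open>u\<close> and by the product over
      \<open>N\<close> combine coordinatewise: by disjointness of supports only one of the two
      contributes at \<open>x\<close>.\<close>
    have "(\<Sum>v\<in>#N + replicate_mset c u. v x) \<le> w x" for x
    proof (cases "u x = 0")
      case False
      then have "(\<Sum>v\<in>#N. v x) = 0"
        using N(1) disj[of _ x] by (auto simp: multisets_of_size_def)
      then have eq: "(\<Sum>v\<in>#N + replicate_mset c u. v x) = c * u x"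
        by simp
      show ?thesis
        unfolding eq using 2(2) by blast
    qed (use N(2) in simp)
    then show ?thesis
      using N(1) \<open>c < k\<close>
      by (intro power_exponentsI[of "N + replicate_mset c u"]) (auto simp: multisets_of_size_def)
  qed
qed

section \<open>Cone partitions of the powers, for the lower bound\<close>

text \<open>Induction on the generators, for all \<open>k\<close> at once. The multiples of the
  \<open>k\<close>-th power of the new generator form one full orthant. Each lower layer has
  codimension 1, to which the induction hypothesis for the exponent \<open>k - c\<close> adds
  \<open>card U - 1\<close>.\<close>

lemma cone_partitionable_power_exponents:
  fixes U :: "('x::finite \<Rightarrow> nat) set"
  assumes "finite U" and "U \<noteq> {}" and "k \<ge> 1"
    and "\<And>u v x. u \<in> U \<Longrightarrow> v \<in> U \<Longrightarrow> u \<noteq> v \<Longrightarrow> u x = 0 \<or> v x = 0"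
  shows "cone_partitionable (card U - 1) (power_exponents U k)"
  using assms
proof (induction U arbitrary: k rule: finite_ne_induct)
  case (singleton u)
  then show ?case
    by (simp add: power_exponents_singleton flip: cone_UNIV) (intro cone_partitionable_cone, simp)
next
  case (insert u U)
  let ?S = "\<lambda>c. {(\<lambda>x. c * u x)..} - {(\<lambda>x. Suc c * u x)..}"
  have "u \<noteq> v" if "v \<in> U" for v
    using insert.hyps that by metis
  then have disj: "u x = 0 \<or> v x = 0" if "v \<in> U" for v x
    using insert.prems(2)[of u v x] that by simp
  have anti: "{(\<lambda>x. n * u x)..} \<subseteq> {(\<lambda>x. m * u x)..}" if "m \<le> n" for m n
    using that by (auto simp: le_fun_def intro: order_trans mult_right_mono)
  have disj_Diff: "A \<inter> (B - C) = {}" if "A \<subseteq> C" for A B C :: "('x \<Rightarrow> nat) set"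
    using that by blast
  have "?S c \<inter> ?S d = {}" if "c < d" for c d
    using anti[of "Suc c" d] that by auto
  then have "?S c \<inter> ?S d = {}" if "c \<noteq> d" for c d
    using that by (metis Int_commute linorder_neq_iff)
  then have fam: "disjoint_family_on (\<lambda>c. ?S c \<inter> power_exponents U (k - c)) {..<k}"
    unfolding disjoint_family_on_def by blast
  have "cone_partitionable (card U) (?S c \<inter> power_exponents U (k - c))" if "c < k" for c
  proof -
    have "cone_partitionable 1 (?S c)"
      by (intro cone_partitionable_orthant_Diff) (simp add: le_fun_def)
    moreover have "cone_partitionable (card U - 1) (power_exponents U (k - c))"
      using insert that by auto
    ultimately have "cone_partitionable (1 + (card U - 1)) (?S c \<inter> power_exponents U (k - c))"
      by (rule cone_partitionable_Int)
    then show ?thesis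
      using insert.hyps by (simp add: Suc_leI card_gt_0_iff)
  qed
  then have "cone_partitionable (card U) (\<Union>c<k. ?S c \<inter> power_exponents U (k - c))"
    using fam by (intro cone_partitionable_UN) auto
  moreover have "cone_partitionable (card U) {(\<lambda>x. k * u x)..}"
    unfolding cone_UNIV[symmetric] by (intro cone_partitionable_cone) simp
  moreover have "{(\<lambda>x. k * u x)..} \<inter> (\<Union>c<k. ?S c \<inter> power_exponents U (k - c)) = {}"
  proof -
    have "{(\<lambda>x. k * u x)..} \<inter> ?S c = {}" if "c < k" for c
      by (rule disj_Diff[OF anti[OF Suc_leI[OF that]]])
    then show ?thesis by blast
  qed
  moreover have "power_exponents (insert u U) k =
      {(\<lambda>x. k * u x)..} \<union> (\<Union>c<k. ?S c \<inter> power_exponents U (k - c))"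
    using insert.hyps(3) disj by (rule power_exponents_insert)
  ultimately show ?case
    using cone_partitionable_Un[of "card U" "{(\<lambda>x. k * u x)..}"] insert.hyps by simp
qed

section \<open>Counting multisets in cones, for the upper bound\<close>

text \<open>
  Fixing the exponents of all but \<open>card U\<close> many variables, one for each element of \<open>U\<close>, at a large
  value \<open>N\<close> embeds the multisets over \<open>U\<close> into the exponent vectors such that exactly the multisets
  of size at least \<open>k\<close> land in \<open>power_exponents U k\<close>. A cone containing the image of a multiset of
  size \<open>k\<close> contains the images of at least \<open>d + card U - CARD('x)\<close> multisets of size \<open>Suc k\<close>, and
  no multiset of size \<open>Suc k\<close> is counted twice.
\<close>

lemma power_exponents_cone_dimension_bound:
  fixes U :: "('x::finite \<Rightarrow> nat) set"
  assumes "finite U" and "U \<noteq> {}" and "k \<ge> 1"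
    and disj: "\<And>u v x. u \<in> U \<Longrightarrow> v \<in> U \<Longrightarrow> u \<noteq> v \<Longrightarrow> u x = 0 \<or> v x = 0"
    and nz: "\<And>u. u \<in> U \<Longrightarrow> \<exists>x. u x \<noteq> 0"
    and cover: "power_exponents U k = (\<Union>i\<in>I. cone (a i) (Z i))"
    and fam: "disjoint_family_on (\<lambda>i. cone (a i) (Z i)) I"
    and d: "\<And>i. i \<in> I \<Longrightarrow> d \<le> card (Z i)"
  shows "(d + card U - CARD('x)) * Suc k \<le> card U + k"
proof -
  let ?S = "multisets_of_size U"
  have fin: "finite (?S n)" for n
    using \<open>finite U\<close> by (rule finite_multisets_of_size)
  \<comment> \<open>\<open>p u\<close> is a pivot variable in the support of \<open>u\<close>.
    Disjoint supports make all other generators vanish there, so \<open>p\<close> is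
    injective.\<close>
  obtain p where p: "\<And>u. u \<in> U \<Longrightarrow> u (p u) \<noteq> 0"
    using nz by metis
  have other: "v (p u) = 0" if "u \<in> U" "v \<in> U" "u \<noteq> v" for u v
    using disj[OF that, of "p u"] p that by auto
  have inj: "inj_on p U"
    using other p by (metis inj_onI)
  have "finite ((\<lambda>(M, x). \<Sum>u\<in>#M. u x) ` (?S k \<times> UNIV))"
    using fin by auto
  \<comment> \<open>\<open>N\<close> exceeds every exponent in a product of \<open>k\<close>
    generators, so non-pivot coordinates set to \<open>N\<close> never obstruct
    divisibility.\<close>
  then obtain N where "\<forall>n \<in> (\<lambda>(M, x). \<Sum>u\<in>#M. u x) ` (?S k \<times> UNIV). n < N"
    using finite_nat_set_iff_bounded by meson
  then have N: "\<And>M x. M \<in> ?S k \<Longrightarrow> (\<Sum>u\<in>#M. u x) < N"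
    by fastforce
  \<comment> \<open>At a pivot, \<open>inv_into\<close> recovers the generator; the exponent there
    is exactly the one in the product encoded by \<open>M\<close>.\<close>
  define e where "e M x = (if x \<in> p ` U then count M (inv_into U p x) * inv_into U p x x else N)"
    for M x
  have e_p: "e M (p u) = count M u * u (p u)" if "u \<in> U" for M u
    using that inj by (simp add: e_def)
  have e_N: "e M x = N" if "x \<notin> p ` U" for M x
    using that by (simp add: e_def)
  have sum_p: "(\<Sum>v\<in>#M. v (p u)) = count M u * u (p u)" if "u \<in> U" "set_mset M \<subseteq> U" for M u
    using that(2) by (induction M) (use other that(1) in auto)
  have e_in: "e M \<in> power_exponents U k" if M: "M \<in> ?S k" for M
  proof (rule power_exponentsI[OF M])
    fix x show "(\<Sum>u\<in>#M. u x) \<le> e M x"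
    proof (cases "x \<in> p ` U")
      case True
      then show ?thesis using M e_p sum_p by (auto simp: multisets_of_size_def)
    next
      case False
      then show ?thesis using N[OF M, of x] e_N by simp
    qed
  qed
  have e_notin: "e L \<notin> power_exponents U k" if L: "size L < k" for L
  proof
    assume "e L \<in> power_exponents U k"
    then obtain M where M: "M \<in> ?S k" "\<And>x. (\<Sum>u\<in>#M. u x) \<le> e L x"
      by (auto simp: power_exponents_def)
    \<comment> \<open>Comparing exponents at the pivots recovers the multiplicities, so divisibility
      would force a multiset of size \<open>k\<close> into the smaller \<open>L\<close>.\<close>
    have "M \<subseteq># L"
    proof (rule mset_subset_eqI)
      fix u show "count M u \<le> count L u"
      proof (cases "u \<in> U")
        case True
        then have "count M u * u (p u) \<le> count L u * u (p u)"
          using M(2)[of "p u"] M(1) sum_p e_p by (auto simp: multisets_of_size_def)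
        then show ?thesis using p[OF True] by simp
      next
        case False
        then have "u \<notin># M" using M(1) by (auto simp: multisets_of_size_def)
        then show ?thesis by (simp add: not_in_iff)
      qed
    qed
    then show False
      using size_mset_mono M(1) L by (fastforce simp: multisets_of_size_def)
  qed
  have "\<forall>M\<in>?S k. \<exists>i\<in>I. e M \<in> cone (a i) (Z i)"
    using e_in cover by blast
  then obtain i where i: "\<And>M. M \<in> ?S k \<Longrightarrow> i M \<in> I"
    and e_cone: "\<And>M. M \<in> ?S k \<Longrightarrow> e M \<in> cone (a (i M)) (Z (i M))"
    by metis
  \<comment> \<open>\<open>D M\<close> collects the generators whose pivot is a free direction of
    the cone containing \<open>e M\<close>; adding one of them to \<open>M\<close> does not leave
    that cone.\<close>
  define D where "D M = {u \<in> U. p u \<in> Z (i M)}" for M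
  have card_D: "d + card U - CARD('x) \<le> card (D M)" if M: "M \<in> ?S k" for M
  proof -
    \<comment> \<open>All but \<open>CARD('x) - card U\<close> free directions must be pivots, which
      bounds \<open>card (D M)\<close> from below.\<close>
    have "Z (i M) \<subseteq> p ` D M \<union> - (p ` U)"
      unfolding D_def by auto
    then have "card (Z (i M)) \<le> card (p ` D M) + card (- (p ` U))"
      by (meson card_Un_le card_mono finite order_trans)
    moreover have "card (p ` D M) \<le> card (D M)"
      using \<open>finite U\<close> by (intro card_image_le) (simp add: D_def)
    moreover have "card (- (p ` U)) = CARD('x) - card U"
      using card_image[OF inj] by (simp add: Compl_eq_Diff_UNIV card_Diff_subset)
    moreover have "card U \<le> CARD('x)"
      using card_image[OF inj] by (metis card_mono finite subset_UNIV)
    ultimately show ?thesis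
      using d[OF i[OF M]] by linarith
  qed
  have e_add: "e (add_mset u M) \<in> cone (a (i M)) (Z (i M))" if "M \<in> ?S k" "u \<in> D M" for M u
  proof -
    have "e M x \<le> e (add_mset u M) x" for x
      by (simp add: e_def)
    moreover have "e (add_mset u M) x = e M x" if "x \<notin> Z (i M)" for x
    proof (cases "x \<in> p ` U")
      case True
      then show ?thesis using that \<open>u \<in> D M\<close> e_p by (auto simp: D_def)
    qed (simp add: e_N)
    ultimately show ?thesis
      using e_cone[OF that(1)] unfolding cone_def by simp (metis order_trans)
  qed
  have inj_add: "inj_on (\<lambda>(M, u). add_mset u M) (Sigma (?S k) D)"
  proof (rule inj_onI, clarify)
    fix M u M' u'
    assume M: "M \<in> ?S k" and u: "u \<in> D M" and M': "M' \<in> ?S k" and u': "u' \<in> D M'"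
      and eq: "add_mset u M = add_mset u' M'"
    show "M = M' \<and> u = u'"
    proof (rule ccontr)
      assume "\<not> (M = M' \<and> u = u')"
      then have "u \<noteq> u'" using eq by auto
      \<comment> \<open>If one multiset of size \<open>Suc k\<close> arose twice, \<open>L\<close>
        would be the common part, of size \<open>k - 1\<close>. Both cones contain the image of the
        larger multiset and hence coincide.\<close>
      then obtain L where L: "M = add_mset u' L" "M' = add_mset u L"
        using eq by (auto simp: add_eq_conv_ex)
      have "i M = i M'"
        using e_add[OF M u] e_add[OF M' u'] eq i[OF M] i[OF M'] fam
        unfolding disjoint_family_on_def by (metis IntI empty_iff)
      then have u'Z: "p u' \<in> Z (i M)"
        using u' by (simp add: D_def)
      \<comment> \<open>This puts \<open>e L\<close> into the same cone: at the free coordinate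
        \<open>p u'\<close> it agrees with \<open>e M'\<close>, elsewhere with \<open>e M\<close>.
        But \<open>L\<close> is too small for \<open>power_exponents U k\<close>.\<close>
      have "if x \<in> Z (i M) then a (i M) x \<le> e L x else e L x = a (i M) x" for x
      proof (cases "x = p u'")
        case True
        then have "e L x = e M' x"
          using L(2) \<open>u \<noteq> u'\<close> u' e_p by (simp add: D_def)
        moreover have "a (i M) x \<le> e M' x"
          using e_cone[OF M'] u'Z \<open>i M = i M'\<close> True by (auto simp: cone_def)
        ultimately show ?thesis
          using u'Z True by simp
      next
        case False
        then have "e L x = e M x"
          using L(1) e_p e_N by (cases "x \<in> p ` U") auto
        then show ?thesis
          using e_cone[OF M] by (auto simp: cone_def)
      qed
      then have "e L \<in> cone (a (i M)) (Z (i M))"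
        by (simp add: cone_def)
      then have "e L \<in> power_exponents U k"
        unfolding cover using i[OF M] by blast
      moreover have "size L < k"
        using M L(1) by (auto simp: multisets_of_size_def)
      ultimately show False
        using e_notin by blast
    qed
  qed
  \<comment> \<open>The pairs \<open>(M, u)\<close> with \<open>u\<close> in \<open>D M\<close> are
    counted by their first component and, through \<open>inj_add\<close>, inside the multisets of
    size \<open>Suc k\<close>.\<close>
  have "card (?S k) * (d + card U - CARD('x)) \<le> (\<Sum>M\<in>?S k. card (D M))"
    using sum_bounded_below[of "?S k" "d + card U - CARD('x)" "\<lambda>M. card (D M)"] card_D by simp
  also have "\<dots> = card (Sigma (?S k) D)"
    using fin \<open>finite U\<close> by (subst card_SigmaI) (auto simp: D_def)
  also have "\<dots> \<le> card (?S (Suc k))"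
    by (rule card_inj_on_le[OF inj_add _ fin]) (auto simp: multisets_of_size_def D_def)
  finally have "(card U + k - 1 choose k) * (d + card U - CARD('x)) \<le> (card U + k choose Suc k)"
    using \<open>finite U\<close> by (simp add: card_multisets_of_size)
  then have "(card U + k - 1 choose k) * (d + card U - CARD('x)) * Suc k
      \<le> (card U + k choose Suc k) * Suc k"
    by (rule mult_right_mono) simp
  also have "\<dots> = (card U + k) * (card U + k - 1 choose k)"
    using Suc_times_binomial_eq[of "card U + k - 1" k] \<open>k \<ge> 1\<close> by simp
  finally have "(card U + k - 1 choose k) * ((d + card U - CARD('x)) * Suc k)
      \<le> (card U + k - 1 choose k) * (card U + k)"
    by (simp only: mult.assoc mult.commute[of "card U + k"])
  moreover have "card U > 0"
    using assms(1,2) by (simp add: card_gt_0_iff)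
  then have "(card U + k - 1 choose k) > 0"
    by (simp add: zero_less_binomial)
  ultimately show ?thesis
    by (metis mult_le_cancel1)
qed


section \<open>Polynomials with prescribed exponents\<close>

text \<open>The \<open>K\<close>-span of the monomials with exponents in \<open>A\<close>. Monomial
  ideals and Stanley spaces of \<open>B\<close> all have this form, which reduces algebra to sets of
  exponents.\<close>

definition polys_on :: "('x \<Rightarrow> nat) set \<Rightarrow> ('x::finite, 'k::field) mpoly set" where
  "polys_on A = {f. \<forall>b\<in>Poly_Mapping.keys f. Poly_Mapping.lookup b \<in> A}"

definition exponent :: "('x::finite \<Rightarrow> nat) \<Rightarrow> ('x \<Rightarrow>\<^sub>0 nat)" where
  "exponent = Poly_Mapping.Abs_poly_mapping"

lemma lookup_exponent [simp]: "Poly_Mapping.lookup (exponent w) = w"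
  by (simp add: exponent_def)

lemma exponent_lookup [simp]: "exponent (Poly_Mapping.lookup b) = b"
  by (simp add: exponent_def)

lemma polys_on_eq_zero: "f \<in> polys_on A \<Longrightarrow> Poly_Mapping.lookup b \<notin> A \<Longrightarrow> Poly_Mapping.lookup f b = 0"
  unfolding polys_on_def by (auto simp: in_keys_iff)

lemma polys_onI: "(\<And>b. Poly_Mapping.lookup b \<notin> A \<Longrightarrow> Poly_Mapping.lookup f b = 0) \<Longrightarrow> f \<in> polys_on A"
  unfolding polys_on_def by (auto simp: in_keys_iff)

lemma single_in_polys_on:
  "Poly_Mapping.single b c \<in> polys_on A \<longleftrightarrow> c = 0 \<or> Poly_Mapping.lookup b \<in> A"
  by (auto simp: polys_on_def)

lemma polys_on_mono: "A \<subseteq> B \<Longrightarrow> polys_on A \<subseteq> polys_on B"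
  by (auto simp: polys_on_def)

lemma polys_on_inject:
  assumes "(polys_on A :: ('x::finite, 'k::field) mpoly set) = polys_on B"
  shows "A = B"
proof -
  have "w \<in> A \<longleftrightarrow> w \<in> B" for w
    using assms single_in_polys_on[of "exponent w" "1::'k" A]
      single_in_polys_on[of "exponent w" "1::'k" B] by simp
  then show ?thesis by blast
qed

lemma polys_on_add: "f \<in> polys_on A \<Longrightarrow> g \<in> polys_on A \<Longrightarrow> f + g \<in> polys_on A"
  by (intro polys_onI) (simp add: lookup_add polys_on_eq_zero)

lemma polys_on_sum: "(\<And>i. i \<in> I \<Longrightarrow> f i \<in> polys_on A) \<Longrightarrow> sum f I \<in> polys_on A"
  by (intro polys_onI) (auto simp: lookup_sum intro!: sum.neutral polys_on_eq_zero)

lemma polys_on_mult: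
  fixes f g :: "('x::finite, 'k::field) mpoly"
  assumes "f \<in> polys_on A" and "g \<in> polys_on B"
    and "\<And>v w. v \<in> A \<Longrightarrow> w \<in> B \<Longrightarrow> (\<lambda>x. v x + w x) \<in> C"
  shows "f * g \<in> polys_on C"
  unfolding polys_on_def
proof clarify
  fix b assume "b \<in> Poly_Mapping.keys (f * g)"
  then obtain p q where "b = p + q" "p \<in> Poly_Mapping.keys f" "q \<in> Poly_Mapping.keys g"
    using keys_mult[of f g] by blast
  moreover have "Poly_Mapping.lookup (p + q) = (\<lambda>x. Poly_Mapping.lookup p x + Poly_Mapping.lookup q x)"
    by (rule ext) (rule lookup_add)
  ultimately show "Poly_Mapping.lookup b \<in> C"
    using assms by (auto simp: polys_on_def)
qed

lemma subspace_polys_on: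
  assumes "\<And>v w. v \<in> A \<Longrightarrow> v \<le> w \<Longrightarrow> w \<in> A"
  shows "ideal.subspace (polys_on A :: ('x::finite, 'k::field) mpoly set)"
  unfolding ideal.subspace_def
proof (intro conjI ballI allI)
  show "c * f \<in> polys_on A" if "f \<in> polys_on A" for c f :: "('x, 'k) mpoly"
    by (rule polys_on_mult[of c UNIV f A]) (use that assms in \<open>auto simp: polys_on_def le_fun_def\<close>)
  show "0 \<in> polys_on A"
    by (simp add: polys_on_def)
qed (rule polys_on_add)

lemma mpoly_eq_sum_single:
  "f = (\<Sum>b\<in>Poly_Mapping.keys f. Poly_Mapping.single b (Poly_Mapping.lookup f b))"
  by (rule poly_mapping_eqI)
    (simp add: lookup_sum lookup_single when_def sum.delta' not_in_keys_iff_lookup_eq_zero)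

text \<open>A polynomial is the sum of its terms, and constants belong to the ring, so monomials
  suffice.\<close>

lemma polys_on_subset_span:
  fixes S :: "('x::finite, 'k::field) mpoly set"
  assumes "\<And>b. Poly_Mapping.lookup b \<in> A \<Longrightarrow> Poly_Mapping.single b 1 \<in> ideal.span S"
  shows "polys_on A \<subseteq> ideal.span S"
proof
  fix f :: "('x, 'k) mpoly" assume f: "f \<in> polys_on A"
  have "Poly_Mapping.single b (Poly_Mapping.lookup f b) \<in> ideal.span S" if "b \<in> Poly_Mapping.keys f" for b
  proof -
    have "Poly_Mapping.single 0 (Poly_Mapping.lookup f b) * Poly_Mapping.single b 1 \<in> ideal.span S"
      using f that assms by (intro ideal.span_scale) (auto simp: polys_on_def)
    then show ?thesis by (simp add: mult_single)
  qed
  then have "(\<Sum>b\<in>Poly_Mapping.keys f. Poly_Mapping.single b (Poly_Mapping.lookup f b)) \<in> ideal.span S"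
    by (rule ideal.span_sum)
  then show "f \<in> ideal.span S"
    by (simp flip: mpoly_eq_sum_single)
qed

section \<open>Monomial ideals and their powers\<close>

abbreviation monomial :: "('x::finite \<Rightarrow> nat) \<Rightarrow> ('x, 'k::field) mpoly" where
  "monomial u \<equiv> Poly_Mapping.single (exponent u) 1"

lemma monomial_eq_iff [simp]: "(monomial u :: ('x::finite, 'k::field) mpoly) = monomial v \<longleftrightarrow> u = v"
proof
  assume "(monomial u :: ('x, 'k) mpoly) = monomial v"
  then have "Poly_Mapping.lookup (monomial v :: ('x, 'k) mpoly) (exponent u) = 1"
    by (metis lookup_single_eq)
  then have "exponent v = exponent u"
    by (simp add: lookup_single when_def split: if_splits)
  then show "u = v"
    by (metis lookup_exponent)
qed simp

lemma inj_monomial: "inj (monomial :: ('x::finite \<Rightarrow> nat) \<Rightarrow> ('x, 'k::field) mpoly)"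
  by (simp add: inj_def)

lemma monomials_eq: "(monomials :: ('x::finite, 'k::field) mpoly set) = range monomial"
proof -
  have "(Poly_Mapping.single b 1 :: ('x, 'k) mpoly) \<in> range monomial" for b
    by (rule range_eqI[of _ _ "Poly_Mapping.lookup b"]) simp
  then show ?thesis
    unfolding monomials_def by auto
qed

lemma single_add_exponent:
  "Poly_Mapping.single (exponent (\<lambda>x. v x + w x)) (1::'k::field)
     = monomial v * (monomial w :: ('x::finite, 'k) mpoly)"
proof -
  have "exponent (\<lambda>x. v x + w x) = exponent v + exponent w"
    by (rule poly_mapping_eqI) (simp add: lookup_add)
  then show ?thesis
    by (simp add: mult_single)
qed

definition multiples :: "('x \<Rightarrow> nat) set \<Rightarrow> ('x \<Rightarrow> nat) set" where
  "multiples U = {w. \<exists>u\<in>U. u \<le> w}"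

text \<open>A monomial ideal is spanned by the monomials divisible by a generator: these exponents
  are upward closed, and each such monomial is a generator times its cofactor.\<close>

lemma span_monomials:
  "ideal.span (monomial ` U) = (polys_on (multiples U) :: ('x::finite, 'k::field) mpoly set)"
proof (rule equalityI)
  show "ideal.span (monomial ` U) \<subseteq> (polys_on (multiples U) :: ('x, 'k) mpoly set)"
    by (intro ideal.span_minimal subspace_polys_on)
      (auto simp: multiples_def single_in_polys_on intro: order_trans)
  show "polys_on (multiples U) \<subseteq> (ideal.span (monomial ` U) :: ('x, 'k) mpoly set)"
  proof (rule polys_on_subset_span)
    fix b :: "'x \<Rightarrow>\<^sub>0 nat" assume "Poly_Mapping.lookup b \<in> multiples U"
    then obtain u where u: "u \<in> U" "u \<le> Poly_Mapping.lookup b"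
      by (auto simp: multiples_def)
    have "b = exponent (\<lambda>x. (Poly_Mapping.lookup b x - u x) + u x)"
      using u(2) by (intro poly_mapping_eqI) (simp add: le_fun_def)
    then have "Poly_Mapping.single b (1::'k) = monomial (\<lambda>x. Poly_Mapping.lookup b x - u x) * monomial u"
      by (metis single_add_exponent)
    then show "Poly_Mapping.single b (1::'k) \<in> ideal.span (monomial ` U)"
      using u(1) by (auto intro: ideal.span_scale ideal.span_base)
  qed
qed

lemma ideal_power_monomials:
  "ideal_power (ideal.span (monomial ` U)) k
     = (polys_on (power_exponents U k) :: ('x::finite, 'k::field) mpoly set)"
proof (induction k)
  case 0
  show ?case by (simp add: power_exponents_0 polys_on_def)
next
  case (Suc k)
  let ?P = "{a * b |a b. a \<in> polys_on (multiples U) \<and> b \<in> polys_on (power_exponents U k)}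
    :: ('x, 'k) mpoly set"
  have "ideal.span ?P = polys_on (power_exponents U (Suc k))"
  proof (rule equalityI)
    show "ideal.span ?P \<subseteq> polys_on (power_exponents U (Suc k))"
    proof (intro ideal.span_minimal subspace_polys_on)
      show "?P \<subseteq> polys_on (power_exponents U (Suc k))"
      proof clarify
        fix a b :: "('x, 'k) mpoly"
        assume "a \<in> polys_on (multiples U)" "b \<in> polys_on (power_exponents U k)"
        then show "a * b \<in> polys_on (power_exponents U (Suc k))"
        proof (rule polys_on_mult)
          fix v w assume "v \<in> multiples U" "w \<in> power_exponents U k"
          then show "(\<lambda>x. v x + w x) \<in> power_exponents U (Suc k)"
            unfolding power_exponents_Suc multiples_def le_fun_def by (auto intro: add_mono)
        qed
      qed
    qed (rule power_exponents_upward)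
    show "polys_on (power_exponents U (Suc k)) \<subseteq> ideal.span ?P"
    proof (rule polys_on_subset_span)
      fix b :: "'x \<Rightarrow>\<^sub>0 nat" assume "Poly_Mapping.lookup b \<in> power_exponents U (Suc k)"
      then obtain u v where u: "u \<in> U" "v \<in> power_exponents U k"
        "\<And>x. u x + v x \<le> Poly_Mapping.lookup b x"
        by (auto simp: power_exponents_Suc)
      \<comment> \<open>All of the excess of \<open>b\<close> over \<open>u + v\<close> is moved
        into the second factor, so that \<open>b\<close> becomes exactly
        \<open>u + v'\<close>.\<close>
      define v' where "v' x = Poly_Mapping.lookup b x - u x" for x
      have "v \<le> v'"
        unfolding le_fun_def v'_def using u(3) by (metis add_le_imp_le_diff add.commute)
      then have v': "v' \<in> power_exponents U k"
        using u(2) by (rule power_exponents_upward[rotated])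
      have "b = exponent (\<lambda>x. u x + v' x)"
        using add_leD1[OF u(3)] by (intro poly_mapping_eqI) (simp add: v'_def)
      then have "Poly_Mapping.single b (1::'k) = monomial u * monomial v'"
        by (metis single_add_exponent)
      moreover have "u \<in> multiples U"
        using u(1) by (auto simp: multiples_def)
      ultimately have "Poly_Mapping.single b 1 \<in> ?P"
        using v' by (force simp: single_in_polys_on)
      then show "Poly_Mapping.single b 1 \<in> ideal.span ?P"
        by (rule ideal.span_base)
    qed
  qed
  then show ?case
    by (simp only: ideal_power.simps Suc.IH) (simp only: span_monomials)
qed


section \<open>Monomial complete intersections\<close>

text \<open>If one generator divided another, the larger one could be dropped without changing the
  ideal; so the exponents form an antichain.\<close>

lemma minimal_monomial_generatorsE:
  fixes J :: "('x::finite, 'k::field) mpoly set"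
  assumes "minimal_monomial_generators J G"
  obtains U where "G = monomial ` U" "J = polys_on (multiples U)"
    "\<And>u v. u \<in> U \<Longrightarrow> v \<in> U \<Longrightarrow> u \<le> v \<Longrightarrow> u = v"
proof -
  have *: "G \<subseteq> monomials" "ideal.span G = J" "\<And>H. H \<subset> G \<Longrightarrow> ideal.span H \<noteq> J"
    using assms by (auto simp: minimal_monomial_generators_def)
  then obtain U where U: "G = monomial ` U"
    unfolding monomials_eq by (metis subset_imageE)
  moreover have J: "J = polys_on (multiples U)"
    using *(2) U span_monomials by metis
  moreover have "u = v" if uv: "u \<in> U" "v \<in> U" "u \<le> v" for u v
  proof (rule ccontr)
    assume "u \<noteq> v"
    have "multiples (U - {v}) = multiples U"
    proof (intro equalityI subsetI)
      fix w assume "w \<in> multiples U"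
      then obtain z where z: "z \<in> U" "z \<le> w" by (auto simp: multiples_def)
      show "w \<in> multiples (U - {v})"
      proof (cases "z = v")
        case True
        then show ?thesis
          using uv z(2) \<open>u \<noteq> v\<close> by (auto simp: multiples_def intro!: bexI[of _ u])
      next
        case False
        then show ?thesis using z by (auto simp: multiples_def)
      qed
    qed (auto simp: multiples_def)
    then have "ideal.span (monomial ` (U - {v})) = J"
      using J span_monomials by metis
    moreover have "monomial ` (U - {v}) \<subset> G"
      using uv(2) unfolding U by (intro image_strict_mono inj_on_subset[OF inj_monomial]) auto
    ultimately show False
      using *(3) by blast
  qed
  ultimately show thesis
    using that by blast
qed

text \<open>An antichain is the set of minimal elements of its upward closure. This yields the
  uniqueness of the minimal monomial generators.\<close>

lemma multiples_inject:
  fixes U V :: "('x \<Rightarrow> nat) set"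
  assumes "multiples U = multiples V"
    and "\<And>u v. u \<in> U \<Longrightarrow> v \<in> U \<Longrightarrow> u \<le> v \<Longrightarrow> u = v"
    and "\<And>u v. u \<in> V \<Longrightarrow> v \<in> V \<Longrightarrow> u \<le> v \<Longrightarrow> u = v"
  shows "U = V"
proof -
  have "U \<subseteq> V" if m: "multiples U = multiples V" "\<And>u v. u \<in> U \<Longrightarrow> v \<in> U \<Longrightarrow> u \<le> v \<Longrightarrow> u = v"
    for U V :: "('x \<Rightarrow> nat) set"
  proof
    fix u assume u: "u \<in> U"
    then have "u \<in> multiples V" using m(1) by (auto simp: multiples_def)
    then obtain v where v: "v \<in> V" "v \<le> u" by (auto simp: multiples_def)
    then have "v \<in> multiples U" using m(1) by (auto simp: multiples_def)
    then obtain u' where u': "u' \<in> U" "u' \<le> v" by (auto simp: multiples_def)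
    then have "u' = u" using m(2) u v(2) by (meson order_trans)
    then show "u \<in> V" using u' v by simp
  qed
  then show ?thesis
    using assms by (metis subset_antisym)
qed

text \<open>
  For \<open>i < j\<close> the monomial \<open>v = lcm(u\<^sub>i, u\<^sub>j) / u\<^sub>j\<close> multiplies \<open>u\<^sub>j\<close> into the ideal of the earlier
  generators, so one of them divides \<open>v\<close>, which divides \<open>u\<^sub>i\<close>; hence it is \<open>u\<^sub>i = v\<close>, and \<open>u\<^sub>i\<close> and
  \<open>u\<^sub>j\<close> are coprime.
\<close>

lemma regular_sequence_disjoint_supports:
  fixes us :: "('x::finite \<Rightarrow> nat) list"
  assumes "regular_sequence (map monomial us :: ('x, 'k::field) mpoly list)"
    and "\<And>u v. u \<in> set us \<Longrightarrow> v \<in> set us \<Longrightarrow> u \<le> v \<Longrightarrow> u = v"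
    and "i < j" and "j < length us"
  shows "(us ! i) x = 0 \<or> (us ! j) x = 0"
proof -
  define v where "v y = max ((us ! i) y) ((us ! j) y) - (us ! j) y" for y
  have span_take: "ideal.span (set (take j (map monomial us)))
      = (polys_on (multiples (set (take j us))) :: ('x, 'k) mpoly set)"
    by (simp add: take_map span_monomials)
  have in_take: "us ! i \<in> set (take j us)"
    using assms(3,4) by (auto simp: in_set_conv_nth intro!: exI[of _ i])
  have "(monomial (us ! j) * monomial v :: ('x, 'k) mpoly) = monomial (\<lambda>y. (us ! j) y + v y)"
    by (rule single_add_exponent[symmetric])
  moreover have "(\<lambda>y. (us ! j) y + v y) \<in> multiples (set (take j us))"
    using in_take unfolding multiples_def by (auto simp: v_def le_fun_def intro!: bexI[of _ "us ! i"])
  ultimately have "map monomial us ! j * (monomial v :: ('x, 'k) mpoly)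
      \<in> ideal.span (set (take j (map monomial us)))"
    using assms(4) unfolding span_take by (simp add: single_in_polys_on)
  then have "(monomial v :: ('x, 'k) mpoly) \<in> ideal.span (set (take j (map monomial us)))"
    using assms(1,4) unfolding regular_sequence_def by simp
  then have "v \<in> multiples (set (take j us))"
    unfolding span_take by (simp add: single_in_polys_on)
  then obtain u where u: "u \<in> set (take j us)" "u \<le> v"
    by (auto simp: multiples_def)
  have "v \<le> us ! i"
    by (auto simp: v_def le_fun_def)
  moreover have "u = us ! i"
    using assms(2)[of u "us ! i"] u in_take \<open>v \<le> us ! i\<close>
    by (meson in_set_takeD order_trans)
  ultimately have "v x = (us ! i) x"
    using u(2) by (simp add: order_antisym)
  then show ?thesis
    by (auto simp: v_def max_def split: if_splits)
qed

text \<open>The regular sequence enumerates some set of minimal monomial generators; uniqueness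
  identifies it with the given \<open>G\<close>, which therefore inherits disjoint supports.\<close>

lemma complete_intersection_generators:
  fixes J :: "('x::finite, 'k::field) mpoly set"
  assumes "complete_intersection_monomial_ideal J" and "minimal_monomial_generators J G"
  obtains U where "G = monomial ` U" "J = ideal.span (monomial ` U)"
    "\<And>u v x. u \<in> U \<Longrightarrow> v \<in> U \<Longrightarrow> u \<noteq> v \<Longrightarrow> u x = 0 \<or> v x = 0"
proof -
  obtain gs where gs: "minimal_monomial_generators J (set gs)" "regular_sequence gs"
    using assms(1) by (auto simp: complete_intersection_monomial_ideal_def)
  obtain U where U: "G = monomial ` U" "J = polys_on (multiples U)"
    "\<And>u v. u \<in> U \<Longrightarrow> v \<in> U \<Longrightarrow> u \<le> v \<Longrightarrow> u = v"
    using minimal_monomial_generatorsE[OF assms(2)] by metis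
  obtain V where V: "set gs = monomial ` V" "J = polys_on (multiples V)"
    "\<And>u v. u \<in> V \<Longrightarrow> v \<in> V \<Longrightarrow> u \<le> v \<Longrightarrow> u = v"
    using minimal_monomial_generatorsE[OF gs(1)] by metis
  have "multiples U = multiples V"
    using U(2) V(2) by (intro polys_on_inject[where 'k = 'k]) simp
  then have "U = V"
    using U(3) V(3) by (rule multiples_inject)
  define us where "us = map (the_inv monomial) gs"
  have mon: "monomial (the_inv monomial g) = g" if "g \<in> set gs" for g
    using that V(1) by (auto simp: the_inv_f_f[OF inj_monomial])
  have us: "gs = map monomial us"
    unfolding us_def using mon by (simp add: map_idI)
  have "monomial ` set us = (monomial ` U :: ('x, 'k) mpoly set)"
    using V(1) \<open>U = V\<close> us by simp
  then have "set us = U"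
    by (simp only: inj_image_eq_iff[OF inj_monomial])
  have reg: "regular_sequence (map monomial us :: ('x, 'k) mpoly list)"
    using gs(2) us by simp
  have "u x = 0 \<or> v x = 0" if uv: "u \<in> U" "v \<in> U" "u \<noteq> v" for u v x
  proof -
    obtain i j where ij: "i < length us" "us ! i = u" "j < length us" "us ! j = v"
      using uv \<open>set us = U\<close> by (metis in_set_conv_nth)
    then consider "i < j" | "j < i"
      using uv(3) by (metis linorder_neqE_nat)
    then show ?thesis
    proof cases
      case 1
      show ?thesis
        using regular_sequence_disjoint_supports[OF reg _ 1 ij(3), of x] U(3) \<open>set us = U\<close> ij by simp
    next
      case 2
      show ?thesis
        using regular_sequence_disjoint_supports[OF reg _ 2 ij(1), of x] U(3) \<open>set us = U\<close> ij by auto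
    qed
  qed
  then show thesis
    using that U(1,2) span_monomials by metis
qed


section \<open>Stanley decompositions as cone partitions\<close>

lemma polys_in_eq:
  "(polys_in Z :: ('x::finite, 'k::field) mpoly set) = polys_on {w. \<forall>x. x \<notin> Z \<longrightarrow> w x = 0}"
proof -
  have "Poly_Mapping.keys b \<subseteq> Z \<longleftrightarrow> Poly_Mapping.lookup b \<in> {w. \<forall>x. x \<notin> Z \<longrightarrow> w x = 0}"
    for b :: "'x \<Rightarrow>\<^sub>0 nat"
    by (auto simp: in_keys_iff subset_iff)
  then show ?thesis
    by (simp add: polys_in_def polys_on_def)
qed

lemma lookup_times_single:
  fixes u :: "('x::finite, 'k::field) mpoly"
  shows "Poly_Mapping.lookup (u * Poly_Mapping.single a c) (b + a) = Poly_Mapping.lookup u b * c"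
proof -
  have "u * Poly_Mapping.single a c
      = (\<Sum>b\<in>Poly_Mapping.keys u. Poly_Mapping.single (b + a) (Poly_Mapping.lookup u b * c))"
    by (subst mpoly_eq_sum_single[of u]) (simp add: sum_distrib_right mult_single)
  then show ?thesis
    by (auto simp: lookup_sum lookup_single when_def sum.delta' not_in_keys_iff_lookup_eq_zero)
qed

lemma stanley_space_single:
  fixes a :: "'x::finite \<Rightarrow>\<^sub>0 nat" and c :: "'k::field"
  assumes "c \<noteq> 0"
  shows "stanley_space (*) (Poly_Mapping.single a c, Z) = polys_on (cone (Poly_Mapping.lookup a) Z)"
proof (intro equalityI subsetI)
  fix f assume "f \<in> stanley_space (*) (Poly_Mapping.single a c, Z)"
  then obtain u where "f = u * Poly_Mapping.single a c" "u \<in> polys_in Z"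
    by (auto simp: stanley_space_def)
  then show "f \<in> polys_on (cone (Poly_Mapping.lookup a) Z)"
    by (auto simp: polys_in_eq single_in_polys_on cone_def
        intro!: polys_on_mult[of u _ _ "{Poly_Mapping.lookup a}"])
next
  fix f :: "('x, 'k) mpoly" assume f: "f \<in> polys_on (cone (Poly_Mapping.lookup a) Z)"
  \<comment> \<open>The quotient of \<open>f\<close> by the term, formed term by term. The truncated
    difference \<open>b - a\<close> is exact because every exponent of \<open>f\<close> lies in the
    cone at \<open>a\<close>.\<close>
  define u where "u = (\<Sum>b\<in>Poly_Mapping.keys f. Poly_Mapping.single (b - a) (Poly_Mapping.lookup f b / c))"
  have "b - a + a = b" if "b \<in> Poly_Mapping.keys f" for b
  proof (rule poly_mapping_eqI)
    fix x
    have "Poly_Mapping.lookup a x \<le> Poly_Mapping.lookup b x"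
      using f that by (auto simp: polys_on_def cone_def split: if_splits) (metis order_refl)
    then show "Poly_Mapping.lookup (b - a + a) x = Poly_Mapping.lookup b x"
      by (simp add: lookup_add lookup_minus)
  qed
  then have "u * Poly_Mapping.single a c = f"
    unfolding u_def sum_distrib_right mult_single
    using assms by (simp flip: mpoly_eq_sum_single)
  moreover have "u \<in> polys_in Z"
    unfolding u_def polys_in_eq
  proof (rule polys_on_sum)
    fix b assume "b \<in> Poly_Mapping.keys f"
    then have "Poly_Mapping.lookup b \<in> cone (Poly_Mapping.lookup a) Z"
      using f by (simp add: polys_on_def)
    then show "Poly_Mapping.single (b - a) (Poly_Mapping.lookup f b / c)
        \<in> polys_on {w. \<forall>x. x \<notin> Z \<longrightarrow> w x = 0}"
      by (auto simp: single_in_polys_on cone_def lookup_minus)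
  qed
  ultimately show "f \<in> stanley_space (*) (Poly_Mapping.single a c, Z)"
    by (auto simp: stanley_space_def)
qed

definition restrict_poly :: "('x \<Rightarrow> nat) set \<Rightarrow> ('x::finite, 'k::field) mpoly \<Rightarrow> ('x, 'k) mpoly" where
  "restrict_poly C f =
     (\<Sum>b\<in>{b \<in> Poly_Mapping.keys f. Poly_Mapping.lookup b \<in> C}.
        Poly_Mapping.single b (Poly_Mapping.lookup f b))"

lemma lookup_restrict_poly:
  "Poly_Mapping.lookup (restrict_poly C f) b
     = (if Poly_Mapping.lookup b \<in> C then Poly_Mapping.lookup f b else 0)"
  by (auto simp: restrict_poly_def lookup_sum lookup_single when_def sum.delta' in_keys_iff)

lemma restrict_poly_in: "restrict_poly C f \<in> polys_on C"
  by (rule polys_onI) (simp add: lookup_restrict_poly)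

text \<open>Reduces directness to a partition of exponents: one direction tests on monomials, the
  other compares coefficients exponent by exponent. Disjointness is indexed by list position so that
  a repeated nonempty block is rejected.\<close>

lemma internal_direct_sum_polys_on:
  "internal_direct_sum (polys_on A :: ('x::finite, 'k::field) mpoly set) (map polys_on Cs) \<longleftrightarrow>
     A = \<Union>(set Cs) \<and> disjoint_family_on (\<lambda>i. Cs ! i) {..<length Cs}"
    (is "?L \<longleftrightarrow> ?R")
proof
  assume ?L
  then have sum: "(polys_on A :: ('x, 'k) mpoly set)
        = {\<Sum>i<length Cs. v i |v. \<forall>i<length Cs. v i \<in> polys_on (Cs ! i)}"
    and zero: "\<And>v :: nat \<Rightarrow> ('x, 'k) mpoly. (\<And>i. i < length Cs \<Longrightarrow> v i \<in> polys_on (Cs ! i)) \<Longrightarrow>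
        (\<Sum>i<length Cs. v i) = 0 \<Longrightarrow> (\<And>i. i < length Cs \<Longrightarrow> v i = 0)"
    unfolding internal_direct_sum_def by (simp_all add: nth_map cong: conj_cong)
  have "w \<in> \<Union>(set Cs)" if w: "w \<in> A" for w
  proof -
    have "(monomial w :: ('x, 'k) mpoly) \<in> polys_on A"
      using w by (simp add: single_in_polys_on)
    then obtain v :: "nat \<Rightarrow> ('x, 'k) mpoly" where
      v: "monomial w = (\<Sum>i<length Cs. v i)" "\<And>i. i < length Cs \<Longrightarrow> v i \<in> polys_on (Cs ! i)"
      unfolding sum by auto
    have "(\<Sum>i<length Cs. Poly_Mapping.lookup (v i) (exponent w)) = 1"
      by (metis v(1) lookup_sum lookup_single_eq)
    then obtain i where "i < length Cs" "Poly_Mapping.lookup (v i) (exponent w) \<noteq> 0"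
      by (metis lessThan_iff sum.neutral zero_neq_one)
    then show ?thesis
      using v(2) polys_on_eq_zero by (metis UnionI lookup_exponent nth_mem)
  qed
  moreover have "Cs ! i \<subseteq> A" if i: "i < length Cs" for i
  proof
    fix w assume "w \<in> Cs ! i"
    define v :: "nat \<Rightarrow> ('x, 'k) mpoly" where "v l = (if l = i then monomial w else 0)" for l
    have "(\<Sum>l<length Cs. v l) = monomial w"
      using i by (simp add: v_def)
    moreover have "\<forall>l<length Cs. v l \<in> polys_on (Cs ! l)"
      using \<open>w \<in> Cs ! i\<close> by (auto simp: v_def polys_on_def)
    ultimately have "monomial w \<in> (polys_on A :: ('x, 'k) mpoly set)"
      unfolding sum by (intro CollectI exI[of _ v]) simp
    then show "w \<in> A"
      by (simp add: single_in_polys_on)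
  qed
  moreover have "Cs ! i \<inter> Cs ! j = {}" if ij: "i < length Cs" "j < length Cs" "i \<noteq> j" for i j
  proof (rule ccontr)
    assume "Cs ! i \<inter> Cs ! j \<noteq> {}"
    then obtain w where w: "w \<in> Cs ! i" "w \<in> Cs ! j" by auto
    \<comment> \<open>A monomial shared by blocks \<open>i\<close> and \<open>j\<close> gives the
      nontrivial relation in which it cancels against its negative.\<close>
    define v :: "nat \<Rightarrow> ('x, 'k) mpoly" where
      "v l = (if l = i then monomial w else 0) + (if l = j then - monomial w else 0)" for l
    have "v l \<in> polys_on (Cs ! l)" for l
      using w ij(3) by (auto simp: v_def single_in_polys_on polys_on_def simp flip: single_uminus)
    moreover have "(\<Sum>l<length Cs. v l) = 0"
      using ij by (simp add: v_def sum.distrib sum.delta)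
    ultimately have "v i = 0"
      using zero[of v i] ij(1) by blast
    then have "Poly_Mapping.lookup (v i) (exponent w) = 0"
      by simp
    then show False
      using ij(3) by (simp add: v_def)
  qed
  ultimately show ?R
    unfolding disjoint_family_on_def by (auto simp: in_set_conv_nth) blast+
next
  assume R: ?R
  have uniq: "j = i" if "i < length Cs" "j < length Cs" "w \<in> Cs ! i" "w \<in> Cs ! j" for i j w
    using R that unfolding disjoint_family_on_def by (metis IntI empty_iff lessThan_iff)
  have decompose: "f \<in> {\<Sum>i<length Cs. v i |v. \<forall>i<length Cs. v i \<in> polys_on (Cs ! i)}"
    if f: "f \<in> polys_on A" for f :: "('x, 'k) mpoly"
  proof -
    \<comment> \<open>The components of \<open>f\<close> are its restrictions to the blocks; each
      exponent in \<open>A\<close> is picked up by exactly one of them.\<close>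
    have "f = (\<Sum>i<length Cs. restrict_poly (Cs ! i) f)"
    proof (rule poly_mapping_eqI)
      fix b
      show "Poly_Mapping.lookup f b = Poly_Mapping.lookup (\<Sum>i<length Cs. restrict_poly (Cs ! i) f) b"
      proof (cases "Poly_Mapping.lookup b \<in> A")
        case True
        then obtain i where i: "i < length Cs" "Poly_Mapping.lookup b \<in> Cs ! i"
          using R by (auto simp: in_set_conv_nth)
        have "(\<Sum>j<length Cs. Poly_Mapping.lookup (restrict_poly (Cs ! j) f) b)
            = (\<Sum>j<length Cs. if j = i then Poly_Mapping.lookup f b else 0)"
        proof (rule sum.cong)
          fix j assume j: "j \<in> {..<length Cs}"
          show "Poly_Mapping.lookup (restrict_poly (Cs ! j) f) b
              = (if j = i then Poly_Mapping.lookup f b else 0)"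
          proof (cases "j = i")
            case False
            then have "Poly_Mapping.lookup b \<notin> Cs ! j" using uniq i j by blast
            then show ?thesis using False by (simp add: lookup_restrict_poly)
          qed (use i in \<open>simp add: lookup_restrict_poly\<close>)
        qed simp
        then show ?thesis
          using i by (simp add: lookup_sum)
      next
        case False
        then show ?thesis
          using polys_on_eq_zero[OF f False]
          by (simp add: lookup_sum lookup_restrict_poly cong: if_cong)
      qed
    qed
    then show ?thesis
      by (intro CollectI exI[of _ "\<lambda>i. restrict_poly (Cs ! i) f"] conjI)
        (simp_all add: restrict_poly_in)
  qed
  have sum_in: "(\<Sum>i<length Cs. v i) \<in> polys_on A" if v: "\<forall>i<length Cs. v i \<in> polys_on (Cs ! i)"
    for v :: "nat \<Rightarrow> ('x, 'k) mpoly"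
  proof (rule polys_on_sum)
    fix i assume i: "i \<in> {..<length Cs}"
    then have "Cs ! i \<subseteq> A"
      using R nth_mem by blast
    then show "v i \<in> polys_on A"
      using v i polys_on_mono[of "Cs ! i" A] by blast
  qed
  have unique_zero: "v i = 0" if v: "\<forall>i<length Cs. v i \<in> polys_on (Cs ! i)"
    and zero: "(\<Sum>i<length Cs. v i) = 0" and i: "i < length Cs"
    for v :: "nat \<Rightarrow> ('x, 'k) mpoly" and i
  proof (rule poly_mapping_eqI)
    fix b
    show "Poly_Mapping.lookup (v i) b = Poly_Mapping.lookup 0 b"
    proof (cases "Poly_Mapping.lookup b \<in> Cs ! i")
      case True
      have "0 = (\<Sum>j<length Cs. Poly_Mapping.lookup (v j) b)"
        using zero by (metis lookup_sum lookup_zero)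
      also have "\<dots> = (\<Sum>j<length Cs. if j = i then Poly_Mapping.lookup (v i) b else 0)"
      proof (rule sum.cong)
        fix j assume j: "j \<in> {..<length Cs}"
        show "Poly_Mapping.lookup (v j) b = (if j = i then Poly_Mapping.lookup (v i) b else 0)"
        proof (cases "j = i")
          case False
          then have "Poly_Mapping.lookup b \<notin> Cs ! j" using uniq i True j by blast
          then show ?thesis using False v j polys_on_eq_zero[of "v j" "Cs ! j"] by simp
        qed simp
      qed simp
      also have "\<dots> = Poly_Mapping.lookup (v i) b"
        using i by simp
      finally show ?thesis by simp
    next
      case False
      then show ?thesis using v i polys_on_eq_zero[of "v i" "Cs ! i"] by simp
    qed
  qed
  have "(polys_on A :: ('x, 'k) mpoly set)
      = {\<Sum>i<length Cs. v i |v. \<forall>i<length Cs. v i \<in> polys_on (Cs ! i)}"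
    using decompose sum_in by (intro equalityI subsetI) auto
  then show ?L
    unfolding internal_direct_sum_def using unique_zero
    by (intro conjI allI impI) (simp_all add: nth_map cong: conj_cong)
qed

abbreviation ideal_stanley_decomposition ::
    "('x::finite, 'k::field) mpoly set \<Rightarrow> (('x, 'k) mpoly \<times> 'x set) list \<Rightarrow> bool" where
  "ideal_stanley_decomposition M \<equiv> stanley_decomposition (*) (\<lambda>a. M \<inter> poly_component a) M"

lemma times_single_eq_0D:
  fixes u :: "('x::finite, 'k::field) mpoly"
  assumes "u * Poly_Mapping.single a c = 0" and "c \<noteq> 0"
  shows "u = 0"
proof (rule poly_mapping_eqI)
  fix b
  have "Poly_Mapping.lookup u b * c = 0"
    using assms(1) lookup_times_single[of u a c b] by simp
  then show "Poly_Mapping.lookup u b = Poly_Mapping.lookup 0 b"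
    using assms(2) by simp
qed

text \<open>A multidegree determines the exponent vector, so homogeneous components are at most
  one-dimensional.\<close>

lemma homogeneous_eq_single:
  assumes "m \<in> poly_component a" and "m \<noteq> 0"
  shows "\<exists>b c. m = Poly_Mapping.single b c \<and> c \<noteq> 0"
proof -
  obtain b where b: "b \<in> Poly_Mapping.keys m"
    using assms(2) keys_eq_empty by fastforce
  have "b' = b" if "b' \<in> Poly_Mapping.keys m" for b'
  proof (rule poly_mapping_eqI)
    fix x
    have "(\<lambda>x. int (Poly_Mapping.lookup b' x)) = (\<lambda>x. int (Poly_Mapping.lookup b x))"
      using assms(1) b that by (simp add: poly_component_def)
    then have "int (Poly_Mapping.lookup b' x) = int (Poly_Mapping.lookup b x)"
      by (rule fun_cong)
    then show "Poly_Mapping.lookup b' x = Poly_Mapping.lookup b x"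
      by simp
  qed
  then have "Poly_Mapping.keys m = {b}"
    using b by blast
  then have "m = Poly_Mapping.single b (Poly_Mapping.lookup m b)"
    using mpoly_eq_sum_single[of m] by simp
  then show ?thesis
    using b by (metis in_keys_iff)
qed

text \<open>Each cone with base \<open>a\<close> and directions \<open>Z\<close> becomes the Stanley
  space generated by the monomial of exponent \<open>a\<close> over \<open>K[Z]\<close>.\<close>

lemma stanley_decomposition_of_cone_partition:
  fixes A :: "('x::finite \<Rightarrow> nat) set"
  assumes "cone_partitionable c A"
  obtains D where "ideal_stanley_decomposition (polys_on A :: ('x, 'k::field) mpoly set) D"
    and "\<And>m Z. (m, Z) \<in> set D \<Longrightarrow> CARD('x) - c \<le> card Z"
proof -
  obtain P where P: "finite P" "disjoint P" "\<Union>P = A"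
    "\<forall>C\<in>P. \<exists>a Z. C = cone a Z \<and> card (- Z) \<le> c"
    using assms unfolding cone_partitionable_def by metis
  obtain a Z where aZ: "\<And>C. C \<in> P \<Longrightarrow> C = cone (a C) (Z C)" "\<And>C. C \<in> P \<Longrightarrow> card (- Z C) \<le> c"
    using P(4) by metis
  obtain Cs where Cs: "set Cs = P" "distinct Cs"
    using finite_distinct_list[OF P(1)] by blast
  define D :: "(('x, 'k) mpoly \<times> 'x set) list" where "D = map (\<lambda>C. (monomial (a C), Z C)) Cs"
  have "map (stanley_space (*)) D = map polys_on Cs"
    using aZ(1) Cs(1) by (simp add: D_def stanley_space_single)
  moreover have "disjoint_family_on (\<lambda>i. Cs ! i) {..<length Cs}"
    using P(2) Cs unfolding disjoint_family_on_def disjoint_def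
    by (metis lessThan_iff nth_eq_iff_index_eq nth_mem)
  ultimately have "internal_direct_sum (polys_on A) (map (stanley_space (*)) D)"
    using P(3) Cs(1) by (simp add: internal_direct_sum_polys_on)
  moreover have "monomial (a C) \<in> (polys_on A :: ('x, 'k) mpoly set)" if "C \<in> P" for C
    using aZ(1)[OF that] base_in_cone P(3) that by (auto simp: single_in_polys_on)
  moreover have "(monomial w :: ('x, 'k) mpoly) \<in> poly_component (\<lambda>x. int (w x))" for w
    by (simp add: poly_component_def)
  moreover have "u = 0" if "u * monomial w = 0" for u :: "('x, 'k) mpoly" and w
    using times_single_eq_0D[OF that] by simp
  ultimately have "ideal_stanley_decomposition (polys_on A) D"
    unfolding stanley_decomposition_def using Cs(1) by (auto simp: D_def)
  moreover have "CARD('x) - c \<le> card W" if "(m, W) \<in> set D" for m W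
  proof -
    obtain C where "C \<in> P" "W = Z C"
      using \<open>(m, W) \<in> set D\<close> Cs(1) by (auto simp: D_def)
    then show ?thesis
      using aZ(2)[of C] by (simp add: Compl_eq_Diff_UNIV card_Diff_subset)
  qed
  ultimately show thesis
    using that by blast
qed

text \<open>Homogeneous nonzero generators are terms, so every Stanley space is spanned by the
  monomials of a cone with the same directions.\<close>

lemma cone_partition_of_stanley_decomposition:
  fixes A :: "('x::finite \<Rightarrow> nat) set"
  assumes "ideal_stanley_decomposition (polys_on A :: ('x, 'k::field) mpoly set) D"
  obtains a where "A = (\<Union>i<length D. cone (a i) (snd (D ! i)))"
    and "disjoint_family_on (\<lambda>i. cone (a i) (snd (D ! i))) {..<length D}"
proof -
  have D: "\<And>m Z. (m, Z) \<in> set D \<Longrightarrow>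
      (\<exists>a. m \<in> poly_component a) \<and> (\<forall>u\<in>polys_in Z. u * m = 0 \<longrightarrow> u = 0)"
    and sum: "internal_direct_sum (polys_on A) (map (stanley_space (*)) D)"
    using assms unfolding stanley_decomposition_def by auto
  have "\<exists>b c. fst (D ! i) = Poly_Mapping.single b c \<and> c \<noteq> 0" if "i < length D" for i
  proof -
    have mem: "(fst (D ! i), snd (D ! i)) \<in> set D"
      using that by simp
    \<comment> \<open>Freeness tested at the scalar 1 shows that the generator is nonzero.\<close>
    have "(1 :: ('x, 'k) mpoly) \<in> polys_in (snd (D ! i))"
      by (simp add: polys_in_def)
    then have "fst (D ! i) \<noteq> 0"
      using D[OF mem] by fastforce
    then show ?thesis
      using D[OF mem] homogeneous_eq_single by blast
  qed
  then obtain b c where bc: "\<And>i. i < length D \<Longrightarrow> fst (D ! i) = Poly_Mapping.single (b i) (c i)"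
    "\<And>i. i < length D \<Longrightarrow> c i \<noteq> 0"
    by metis
  define C where "C i = cone (Poly_Mapping.lookup (b i)) (snd (D ! i))" for i
  have "map (stanley_space (*)) D = map polys_on (map C [0..<length D])"
  proof (rule nth_equalityI)
    fix i assume "i < length (map (stanley_space (*)) D)"
    then have i: "i < length D" by simp
    then have "D ! i = (Poly_Mapping.single (b i) (c i), snd (D ! i))"
      using bc(1) by (metis prod.collapse)
    then have "stanley_space (*) (D ! i) = polys_on (C i)"
      unfolding C_def using stanley_space_single bc(2)[OF i] by metis
    then show "map (stanley_space (*)) D ! i = map polys_on (map C [0..<length D]) ! i"
      using i by simp
  qed simp
  then have "A = \<Union>(set (map C [0..<length D]))"
    and fam: "disjoint_family_on (\<lambda>i. map C [0..<length D] ! i) {..<length D}"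
    using sum by (simp_all only: internal_direct_sum_polys_on length_map length_upt diff_zero)
  then have "A = (\<Union>i<length D. C i)"
    by (simp add: atLeast0LessThan)
  moreover have "disjoint_family_on C {..<length D}"
    using fam by (simp add: disjoint_family_on_def)
  ultimately show thesis
    using that[of "\<lambda>i. Poly_Mapping.lookup (b i)"] unfolding C_def by blast
qed

section \<open>Bounding and attaining the Stanley depth\<close>

lemma ideal_stanley_decomposition_nonempty:
  assumes "ideal_stanley_decomposition (polys_on A :: ('x::finite, 'k::field) mpoly set) D"
    and "A \<noteq> {}"
  shows "D \<noteq> []"
proof -
  obtain a where "A = (\<Union>i<length D. cone (a i) (snd (D ! i)))"
    using cone_partition_of_stanley_decomposition[OF assms(1)] by metis
  then show ?thesis
    using assms(2) by auto
qed

text \<open>The \<open>Max\<close> in \<open>sdepth\<close> is meaningful only on a finite nonempty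
  set. There may be infinitely many decompositions, but each is a nonempty list, so its
  \<open>Min\<close> is the size of a set of variables.\<close>

lemma finite_sdepth_decompositions:
  assumes "A \<noteq> {}"
  shows "finite (sdepth_decomposition `
    {D. ideal_stanley_decomposition (polys_on A :: ('x::finite, 'k::field) mpoly set) D})"
proof (rule finite_subset[of _ "{..CARD('x)}"])
  show "sdepth_decomposition `
      {D. ideal_stanley_decomposition (polys_on A :: ('x, 'k) mpoly set) D} \<subseteq> {..CARD('x)}"
  proof (rule image_subsetI)
    fix D assume "D \<in> {D. ideal_stanley_decomposition (polys_on A :: ('x, 'k) mpoly set) D}"
    then have "D \<noteq> []"
      using assms unfolding mem_Collect_eq by (rule ideal_stanley_decomposition_nonempty)
    then have "sdepth_decomposition D \<in> (\<lambda>(m, Z). card Z) ` set D"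
      unfolding sdepth_decomposition_def by (intro Min_in) auto
    then show "sdepth_decomposition D \<in> {..CARD('x)}"
      by (auto simp: card_mono)
  qed
qed simp

lemma sdepth_ideal_ge:
  assumes "cone_partitionable c A" and "A \<noteq> {}"
  shows "CARD('x) - c \<le> sdepth_ideal (polys_on A :: ('x::finite, 'k::field) mpoly set)"
proof -
  obtain D where D: "ideal_stanley_decomposition (polys_on A :: ('x, 'k) mpoly set) D"
    and card: "\<And>m Z. (m, Z) \<in> set D \<Longrightarrow> CARD('x) - c \<le> card Z"
    using stanley_decomposition_of_cone_partition[OF assms(1)] by metis
  have "D \<noteq> []"
    using D assms(2) by (rule ideal_stanley_decomposition_nonempty)
  then have "CARD('x) - c \<le> sdepth_decomposition D"
    unfolding sdepth_decomposition_def using card by (subst Min_ge_iff) auto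
  also have "\<dots> \<le> sdepth_ideal (polys_on A :: ('x, 'k) mpoly set)"
    unfolding sdepth_ideal_def sdepth_def
    using D by (intro Max_ge finite_sdepth_decompositions assms(2)) auto
  finally show ?thesis .
qed

text \<open>The partition hypothesis guarantees that some decomposition exists, so the maximum is
  attained; the cones come from an optimal decomposition.\<close>

lemma sdepth_ideal_cones:
  assumes "cone_partitionable c A" and "A \<noteq> {}"
  obtains n :: nat and a Z where
    "A = (\<Union>i<n. cone (a i) (Z i))" "disjoint_family_on (\<lambda>i. cone (a i) (Z i)) {..<n}"
    "\<And>i. i < n \<Longrightarrow> sdepth_ideal (polys_on A :: ('x::finite, 'k::field) mpoly set) \<le> card (Z i)"
proof -
  let ?\<D> = "{D. ideal_stanley_decomposition (polys_on A :: ('x, 'k) mpoly set) D}"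
  have "?\<D> \<noteq> {}"
    using stanley_decomposition_of_cone_partition[OF assms(1)] by blast
  then have "sdepth_ideal (polys_on A :: ('x, 'k) mpoly set) \<in> sdepth_decomposition ` ?\<D>"
    unfolding sdepth_ideal_def sdepth_def by (intro Max_in finite_sdepth_decompositions assms(2)) auto
  then obtain D where D: "ideal_stanley_decomposition (polys_on A :: ('x, 'k) mpoly set) D"
    and eq: "sdepth_ideal (polys_on A :: ('x, 'k) mpoly set) = sdepth_decomposition D"
    by auto
  have "sdepth_decomposition D \<le> card (snd (D ! i))" if "i < length D" for i
    unfolding sdepth_decomposition_def
    using that by (intro Min_le) (auto simp: image_iff case_prod_beta intro!: bexI[of _ "D ! i"])
  then have le: "\<And>i. i < length D \<Longrightarrow>
      sdepth_ideal (polys_on A :: ('x, 'k) mpoly set) \<le> card (snd (D ! i))"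
    by (simp add: eq)
  obtain a where "A = (\<Union>i<length D. cone (a i) (snd (D ! i)))"
    and "disjoint_family_on (\<lambda>i. cone (a i) (snd (D ! i))) {..<length D}"
    by (rule cone_partition_of_stanley_decomposition[OF D])
  then show thesis
    using that[of a "\<lambda>i. snd (D ! i)" "length D"] le by simp
qed

section \<open>Both bounds for the powers of the complete intersection\<close>

theorem proposition2p14:
  fixes J :: "('x::finite, 'k::field) mpoly set"
    and G :: "('x, 'k) mpoly set"
    and s t k :: nat
  assumes "CARD('x) = s" and "s \<ge> 1"
    and "complete_intersection_monomial_ideal J" and "J \<noteq> {0}" and "J \<noteq> UNIV"
    and "minimal_monomial_generators J G" and "finite G" and "card G = t" and "t \<le> s"
    and "k \<ge> 1"
  shows "(int s - int t + 1 \<le> int (sdepth_ideal (ideal_power J k)) \<and>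
          int (sdepth_ideal (ideal_power J k)) \<le> int s - int t + \<lceil>real t / real (k + 1)\<rceil>) \<and>
         (int k \<ge> int t - 1 \<longrightarrow>
          int (sdepth_ideal (ideal_power J k)) = int s - int t + 1)"
proof -
  obtain U where U: "G = monomial ` U" "J = ideal.span (monomial ` U)"
    "\<And>u v x. u \<in> U \<Longrightarrow> v \<in> U \<Longrightarrow> u \<noteq> v \<Longrightarrow> u x = 0 \<or> v x = 0"
    using complete_intersection_generators[OF assms(3,6)] by metis
  have inj: "inj_on (monomial :: _ \<Rightarrow> ('x, 'k) mpoly) U"
    using inj_monomial by (rule inj_on_subset) simp
  have "finite U"
    using assms(7) U(1) finite_image_iff[OF inj] by simp
  have "card U = t"
    using assms(8) U(1) card_image[OF inj] by simp
  have "U \<noteq> {}"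
    using U(2) assms(4) by auto
  have "t \<ge> 1"
    using \<open>finite U\<close> \<open>U \<noteq> {}\<close> \<open>card U = t\<close> by (metis One_nat_def Suc_leI card_gt_0_iff)
  \<comment> \<open>A zero exponent vector would be the generator 1, contradicting properness of
    \<open>J\<close>.\<close>
  have nz: "\<exists>x. u x \<noteq> 0" if "u \<in> U" for u
  proof (rule ccontr)
    assume "\<not> (\<exists>x. u x \<noteq> 0)"
    then have "multiples U = UNIV"
      using that by (auto simp: multiples_def le_fun_def intro!: bexI[of _ u])
    then show False
      using assms(5) U(2) by (simp add: span_monomials polys_on_def)
  qed
  let ?A = "power_exponents U k"
  let ?d = "sdepth_ideal (ideal_power J k)"
  have power: "ideal_power J k = polys_on ?A"
    unfolding U(2) by (rule ideal_power_monomials)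
  have part: "cone_partitionable (t - 1) ?A"
    unfolding \<open>card U = t\<close>[symmetric]
    using \<open>finite U\<close> \<open>U \<noteq> {}\<close> assms(10) U(3) by (rule cone_partitionable_power_exponents)
  obtain u where "u \<in> U" using \<open>U \<noteq> {}\<close> by blast
  then have "(\<lambda>x. k * u x) \<in> ?A"
    by (intro power_exponentsI[of "replicate_mset k u"]) (auto simp: multisets_of_size_def)
  then have "?A \<noteq> {}" by blast
  have "s - (t - 1) \<le> ?d"
    unfolding power using sdepth_ideal_ge[OF part \<open>?A \<noteq> {}\<close>] assms(1) by simp
  then have lower: "int s - int t + 1 \<le> int ?d"
    using assms(9) \<open>t \<ge> 1\<close> by linarith
  obtain n :: nat and a Z where cones: "?A = (\<Union>i<n. cone (a i) (Z i))"
    "disjoint_family_on (\<lambda>i. cone (a i) (Z i)) {..<n}" "\<And>i. i < n \<Longrightarrow> ?d \<le> card (Z i)"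
    using sdepth_ideal_cones[OF part \<open>?A \<noteq> {}\<close>, where 'k = 'k] unfolding power by metis
  \<comment> \<open>\<open>r\<close> is the excess of the depth over \<open>s - t\<close>; by the
    lower bound the subtraction is not truncated.\<close>
  define r where "r = ?d + t - s"
  have "?d \<le> card (Z i)" if "i \<in> {..<n}" for i
    using that cones(3) by simp
  with \<open>finite U\<close> \<open>U \<noteq> {}\<close> assms(10) U(3) nz cones(1,2)
  have "(?d + card U - CARD('x)) * Suc k \<le> card U + k"
    by (rule power_exponents_cone_dimension_bound)
  then have "r * Suc k \<le> t + k"
    by (simp only: r_def \<open>card U = t\<close> assms(1))
  have d: "int ?d = int s - int t + int r"
    using lower assms(9) unfolding r_def by linarith
  \<comment> \<open>From \<open>r * (k + 1) \<le> t + k < t + (k + 1)\<close>. The strict inequality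
    lets the integer \<open>r\<close> be bounded by the ceiling.\<close>
  have "(real r - 1) * real (k + 1) < real t"
  proof -
    have "real (r * Suc k) \<le> real (t + k)"
      using \<open>r * Suc k \<le> t + k\<close> by (simp only: of_nat_le_iff)
    then show ?thesis by (simp add: algebra_simps)
  qed
  then have "real r - 1 < real t / real (k + 1)"
    by (simp add: field_simps)
  then have upper: "int r \<le> \<lceil>real t / real (k + 1)\<rceil>"
    by linarith
  have "int ?d = int s - int t + 1" if "int k \<ge> int t - 1"
  proof -
    have "real t / real (k + 1) \<le> 1"
      using that by (simp add: field_simps)
    then have "\<lceil>real t / real (k + 1)\<rceil> \<le> 1"
      by (simp add: ceiling_le_iff)
    then show ?thesis
      using upper lower d by linarith
  qed
  then show ?thesis
    using lower upper d by simp
qed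

end
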